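(* Let $M$ be a smooth manifold of dimension $n\ge2$ with a Riemannian metric $a=(a_{ij}(x))$ and a nowhere vanishing smooth $1$-form $b=b_i(x)dx^i$. Put $\alpha^2=a_{ij}(x)y^iy^j$, $\beta=b_i(x)y^i$, and for each $x\in M$ let $A_x=\{y\in T_xM: b_i(x)y^i>0\}$, $A=\bigcup_{x\in M}A_x\subset TM$. Then the Kropina metric $F=\alpha^2/\beta:A\to(0,\infty)$ is a conic Finsler metric.
   Context: A conic domain of a real vector space $V$ is a non-empty open subset $A\subset V$ such that $v\in A$ implies $\lambda v\in A$ for all $\lambda>0$. A Minkowski conic norm on $V$ is a map $\|\cdot\|:A\to(0,\infty)$ on a conic domain $A$ such that (i) $\|v\|>0$ for all $v\in A$; (ii) $\|\lambda v\|=\lambda\|v\|$ for all $\lambda>0$, $v\in A$; (iii) $\|\cdot\|$ is smooth on $A$ and its fundamental tensor, i.e. the Hessian of $\frac12\|\cdot\|^2$, is positive definite at every point of $A$. A conic Finsler metric on $M$ is a function $F:A\to[0,\infty)$ where $A\subset TM$ is open with $\pi(A)=M$ ($\pi:TM\to M$ the projection), $A_x:=A\cap T_xM$ is a conic domain of $T_xM$ for each $x\in M$, $F$ is smooth on $A$, and each restriction $F_x=F|_{A_x}$ is a Minkowski conic norm. *)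

theory Defs
  imports "HOL-Analysis.Analysis" "HOL-Library.Function_Algebras"
begin

section \<open>Functions form a real vector space pointwise\<close>

text \<open>HOL-Library.Function_Algebras provides pointwise addition but not scalar multiplication.\<close>

instantiation "fun" :: (type, real_vector) real_vector
begin

definition scaleR_fun :: "real \<Rightarrow> ('a \<Rightarrow> 'b) \<Rightarrow> 'a \<Rightarrow> 'b"
  where "scaleR_fun r f = (\<lambda>x. r *\<^sub>R f x)"

instance
  by standard (auto simp: scaleR_fun_def fun_eq_iff algebra_simps)

end

lemma scaleR_fun_apply [simp]: "(r *\<^sub>R f) x = r *\<^sub>R f x"
  by (simp add: scaleR_fun_def)


section \<open>Smooth maps between Euclidean spaces\<close>

text \<open>The following notions are meant for open \<open>S\<close>; then the values of \<open>f\<close> outside \<open>S\<close>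
  are irrelevant.\<close>

primrec Ck_on :: "nat \<Rightarrow> 'e::euclidean_space set \<Rightarrow> ('e \<Rightarrow> 'b::real_normed_vector) \<Rightarrow> bool" where
  "Ck_on 0 S f \<longleftrightarrow> continuous_on S f"
| "Ck_on (Suc k) S f \<longleftrightarrow> (\<forall>x\<in>S. f differentiable (at x)) \<and>
     (\<forall>u. Ck_on k S (\<lambda>x. frechet_derivative f (at x) u))"

definition smooth_on :: "'e::euclidean_space set \<Rightarrow> ('e \<Rightarrow> 'b::real_normed_vector) \<Rightarrow> bool" where
  "smooth_on S f \<longleftrightarrow> (\<forall>k. Ck_on k S f)"

definition hessian :: "('e::euclidean_space \<Rightarrow> real) \<Rightarrow> 'e \<Rightarrow> 'e \<Rightarrow> 'e \<Rightarrow> real" where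
  "hessian f v u w = frechet_derivative (\<lambda>y. frechet_derivative f (at y) u) (at v) w"


section \<open>Smooth manifolds\<close>

text \<open>A chart is a pair of its domain and its coordinate map; the values of the coordinate map
  outside the domain are irrelevant.  The model space \<open>'e\<close> is \<open>real ^ 'n\<close> in applications, and
  \<open>(real ^ 'n) \<times> (real ^ 'n)\<close> for tangent bundles.\<close>

type_synonym ('m, 'e) chart = "'m set \<times> ('m \<Rightarrow> 'e)"

definition chart_inv :: "('m, 'e) chart \<Rightarrow> 'e \<Rightarrow> 'm" where
  "chart_inv c = inv_into (fst c) (snd c)"

definition transition :: "('m, 'e) chart \<Rightarrow> ('m, 'e) chart \<Rightarrow> 'e \<Rightarrow> 'e" where
  "transition c d = snd d \<circ> chart_inv c"

definition smooth_manifold ::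
    "'m topology \<Rightarrow> ('m, 'e::euclidean_space) chart set \<Rightarrow> bool" where
  "smooth_manifold X \<A> \<longleftrightarrow>
     Hausdorff_space X \<and> second_countable X \<and>
     (\<Union>c\<in>\<A>. fst c) = topspace X \<and>
     (\<forall>c\<in>\<A>. openin X (fst c) \<and> open (snd c ` fst c) \<and>
        homeomorphic_map (subtopology X (fst c)) (top_of_set (snd c ` fst c)) (snd c)) \<and>
     (\<forall>c\<in>\<A>. \<forall>d\<in>\<A>. smooth_on (snd c ` (fst c \<inter> fst d)) (transition c d))"

text \<open>Smoothness of a real function on an open subset \<open>A\<close> of a manifold, and the topology
  defined by an atlas.\<close>

definition manifold_smooth_on ::
    "('m, 'e::euclidean_space) chart set \<Rightarrow> 'm set \<Rightarrow> ('m \<Rightarrow> real) \<Rightarrow> bool" where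
  "manifold_smooth_on \<A> A f \<longleftrightarrow> (\<forall>c\<in>\<A>. smooth_on (snd c ` (fst c \<inter> A)) (f \<circ> chart_inv c))"

definition atlas_topology :: "('m, 'e::euclidean_space) chart set \<Rightarrow> 'm topology" where
  "atlas_topology \<A> =
     topology_generated_by {{q \<in> fst c. snd c q \<in> W} | c W. c \<in> \<A> \<and> open W}"


section \<open>Tangent spaces and the tangent bundle\<close>

definition charts_at :: "('m, 'e) chart set \<Rightarrow> 'm \<Rightarrow> ('m, 'e) chart set" where
  "charts_at \<A> x = {c \<in> \<A>. x \<in> fst c}"

text \<open>A tangent vector at \<open>x\<close> is given by its components \<open>v c\<close> in all charts \<open>c\<close> around \<open>x\<close>,
  which transform by the derivative of the coordinate changes.  It is \<open>0\<close> at the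
  other charts, so that distinct functions are distinct tangent vectors.  The vector space
  operations are pointwise.\<close>

type_synonym ('m, 'e) tvec = "('m, 'e) chart \<Rightarrow> 'e"

definition tangent_space ::
    "('m, 'e::euclidean_space) chart set \<Rightarrow> 'm \<Rightarrow> ('m, 'e) tvec set" where
  "tangent_space \<A> x = {v.
     (\<forall>c. c \<notin> charts_at \<A> x \<longrightarrow> v c = 0) \<and>
     (\<forall>c\<in>charts_at \<A> x. \<forall>d\<in>charts_at \<A> x.
        v d = frechet_derivative (transition c d) (at (snd c x)) (v c))}"

text \<open>The tangent vector at \<open>x\<close> with components \<open>w\<close> in the chart \<open>c\<close>; for \<open>w\<close> the
  \<open>i\<close>-th basis vector this is the coordinate vector \<open>\<partial>/\<partial>x\<^sup>i\<close>.\<close>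

definition tvec_of :: "('m, 'e::euclidean_space) chart set \<Rightarrow> 'm \<Rightarrow> ('m, 'e) chart \<Rightarrow> 'e
    \<Rightarrow> ('m, 'e) tvec" where
  "tvec_of \<A> x c = inv_into (tangent_space \<A> x) (\<lambda>v. v c)"

definition tangent_bundle :: "('m, 'e::euclidean_space) chart set \<Rightarrow> ('m \<times> ('m, 'e) tvec) set" where
  "tangent_bundle \<A> = (SIGMA x : (\<Union>c\<in>\<A>. fst c). tangent_space \<A> x)"

definition tangent_chart :: "('m, 'e::euclidean_space) chart set \<Rightarrow> ('m, 'e) chart
    \<Rightarrow> ('m \<times> ('m, 'e) tvec, 'e \<times> 'e) chart" where
  "tangent_chart \<A> c =
     ((SIGMA x : fst c. tangent_space \<A> x), (\<lambda>(x, v). (snd c x, v c)))"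

definition tangent_atlas :: "('m, 'e::euclidean_space) chart set
    \<Rightarrow> ('m \<times> ('m, 'e) tvec, 'e \<times> 'e) chart set" where
  "tangent_atlas \<A> = tangent_chart \<A> ` \<A>"

lemma topspace_tangent_bundle: "topspace (atlas_topology (tangent_atlas \<A>)) = tangent_bundle \<A>"
proof -
  have "{{q \<in> fst c. snd c q \<in> W} | c W. c \<in> tangent_atlas \<A> \<and> open W} \<subseteq>
      Pow (\<Union>c\<in>tangent_atlas \<A>. fst c)"
    by blast
  moreover have "fst c \<in> {{q \<in> fst c. snd c q \<in> W} | c W. c \<in> tangent_atlas \<A> \<and> open W}"
    if "c \<in> tangent_atlas \<A>" for c
    using that open_UNIV by blast
  ultimately have "topspace (atlas_topology (tangent_atlas \<A>)) = (\<Union>c\<in>tangent_atlas \<A>. fst c)"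
    unfolding atlas_topology_def topology_generated_by_topspace by blast
  also have "\<dots> = tangent_bundle \<A>"
    unfolding tangent_atlas_def tangent_chart_def tangent_bundle_def by auto
  finally show ?thesis .
qed

lemma transition_differentiable:
  assumes "smooth_manifold X \<A>" "c \<in> charts_at \<A> x" "d \<in> charts_at \<A> x"
  shows "transition c d differentiable (at (snd c x))"
proof -
  have A: "c \<in> \<A>" "d \<in> \<A>" "x \<in> fst c \<inter> fst d"
    using assms by (auto simp: charts_at_def)
  then have "smooth_on (snd c ` (fst c \<inter> fst d)) (transition c d)"
    using assms(1) unfolding smooth_manifold_def by blast
  then have "Ck_on (Suc 0) (snd c ` (fst c \<inter> fst d)) (transition c d)"
    unfolding smooth_on_def by blast
  then show ?thesis unfolding Ck_on.simps(2) using A(3) by blast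
qed

lemma subspace_tangent_space:
  assumes "smooth_manifold X \<A>"
  shows "subspace (tangent_space \<A> x)"
proof -
  have lin: "linear (frechet_derivative (transition c d) (at (snd c x)))"
    if "c \<in> charts_at \<A> x" "d \<in> charts_at \<A> x" for c d
    using transition_differentiable[OF assms that] by (rule linear_frechet_derivative)
  show ?thesis
  proof (rule subspaceI)
    show "0 \<in> tangent_space \<A> x"
      unfolding tangent_space_def using linear_0[OF lin] by fastforce
    show "u + v \<in> tangent_space \<A> x"
      if u: "u \<in> tangent_space \<A> x" and v: "v \<in> tangent_space \<A> x" for u v
      unfolding tangent_space_def
    proof (intro CollectI conjI allI impI ballI)
      fix c assume "c \<notin> charts_at \<A> x"
      then have "u c = 0" "v c = 0" using u v unfolding tangent_space_def by blast+
      then show "(u + v) c = 0" by simp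
    next
      fix c d assume cd: "c \<in> charts_at \<A> x" "d \<in> charts_at \<A> x"
      let ?L = "frechet_derivative (transition c d) (at (snd c x))"
      have "u d = ?L (u c)" "v d = ?L (v c)"
        using u v cd unfolding tangent_space_def by blast+
      then show "(u + v) d = ?L ((u + v) c)" using linear_add[OF lin[OF cd]] by simp
    qed
    show "r *\<^sub>R u \<in> tangent_space \<A> x" if u: "u \<in> tangent_space \<A> x" for r u
      unfolding tangent_space_def
    proof (intro CollectI conjI allI impI ballI)
      fix c assume "c \<notin> charts_at \<A> x"
      then have "u c = 0" using u unfolding tangent_space_def by blast
      then show "(r *\<^sub>R u) c = 0" by simp
    next
      fix c d assume cd: "c \<in> charts_at \<A> x" "d \<in> charts_at \<A> x"
      let ?L = "frechet_derivative (transition c d) (at (snd c x))"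
      have "u d = ?L (u c)" using u cd unfolding tangent_space_def by blast
      then show "(r *\<^sub>R u) d = ?L ((r *\<^sub>R u) c)"
        using linear_scale[OF lin[OF cd]] by simp
    qed
  qed
qed

lemma bij_betw_tangent_components:
  assumes M: "smooth_manifold X \<A>" and c: "c \<in> charts_at \<A> x"
  shows "bij_betw (\<lambda>v. v c) (tangent_space \<A> x) UNIV"
proof (rule bij_betw_imageI)
  show "inj_on (\<lambda>v. v c) (tangent_space \<A> x)"
  proof (rule inj_onI)
    fix v w assume v: "v \<in> tangent_space \<A> x" and w: "w \<in> tangent_space \<A> x" and eq: "v c = w c"
    show "v = w"
    proof
      fix d
      have "v d = frechet_derivative (transition c d) (at (snd c x)) (v c) \<and>
            w d = frechet_derivative (transition c d) (at (snd c x)) (w c)"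
        if "d \<in> charts_at \<A> x" using v w c that unfolding tangent_space_def by blast
      moreover have "v d = 0 \<and> w d = 0"
        if "d \<notin> charts_at \<A> x" using v w that unfolding tangent_space_def by blast
      ultimately show "v d = w d" using eq by metis
    qed
  qed
next
  have inj: "inj_on (snd c) (fst c)" if "c \<in> \<A>" for c
  proof -
    have "homeomorphic_map (subtopology X (fst c)) (top_of_set (snd c ` fst c)) (snd c)"
      "openin X (fst c)"
      using M that by (auto simp: smooth_manifold_def)
    then show ?thesis
      by (metis homeomorphic_imp_injective_map openin_subset topspace_subtopology_subset)
  qed
  have op: "open (snd c ` (fst c \<inter> U))" if "c \<in> \<A>" "openin X U" for c U
  proof -
    have h: "homeomorphic_map (subtopology X (fst c)) (top_of_set (snd c ` fst c)) (snd c)"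
      "openin X (fst c)" "open (snd c ` fst c)"
      using M that by (auto simp: smooth_manifold_def)
    have "openin (subtopology X (fst c)) (fst c \<inter> U)"
      using that by (metis Int_commute openin_subtopology_Int)
    then have "openin (top_of_set (snd c ` fst c)) (snd c ` (fst c \<inter> U))"
      using h(1) homeomorphic_imp_open_map open_map_def by blast
    then show ?thesis using h(3) openin_open_trans by blast
  qed
  have dom: "openin X (fst c)" if "c \<in> \<A>" for c
    using M that by (auto simp: smooth_manifold_def)
  note diff = transition_differentiable[OF M]
  have cocycle: "frechet_derivative (transition d e) (at (snd d x))
         (frechet_derivative (transition c d) (at (snd c x)) w)
       = frechet_derivative (transition c e) (at (snd c x)) w"
    if C: "c \<in> charts_at \<A> x" and D: "d \<in> charts_at \<A> x" and E: "e \<in> charts_at \<A> x" for c d e w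
  proof -
    let ?S = "snd c ` (fst c \<inter> fst d)"
    have CA: "c \<in> \<A>" "d \<in> \<A>" "x \<in> fst c" "x \<in> fst d"
      using C D by (auto simp: charts_at_def)
    have inv: "chart_inv c (snd c y) = y" if "y \<in> fst c" for y
      using that inj[OF CA(1)] by (simp add: chart_inv_def)
    have inv': "chart_inv d (snd d y) = y" if "y \<in> fst d" for y
      using that inj[OF CA(2)] by (simp add: chart_inv_def)
    have cx: "transition c d (snd c x) = snd d x"
      by (simp add: transition_def inv CA)
    have d1: "(transition c d has_derivative frechet_derivative (transition c d) (at (snd c x)))
        (at (snd c x))"
      using diff[OF C D] frechet_derivative_works by blast
    have d2: "(transition d e has_derivative frechet_derivative (transition d e) (at (snd d x)))
        (at (transition c d (snd c x)))"
      using diff[OF D E] frechet_derivative_works cx by metis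
    have "((transition d e \<circ> transition c d) has_derivative
        frechet_derivative (transition d e) (at (snd d x)) \<circ>
        frechet_derivative (transition c d) (at (snd c x))) (at (snd c x))"
      using diff_chain_at[OF d1 d2] .
    then have "(transition c e has_derivative
        frechet_derivative (transition d e) (at (snd d x)) \<circ>
        frechet_derivative (transition c d) (at (snd c x))) (at (snd c x))"
    proof (rule has_derivative_transform_within_open[of _ _ _ _ ?S])
      show "open ?S" using op[OF CA(1) dom[OF CA(2)]] .
      show "snd c x \<in> ?S" using CA by blast
      show "(transition d e \<circ> transition c d) p = transition c e p" if "p \<in> ?S" for p
        using that by (auto simp: transition_def inv inv')
    qed
    then show ?thesis by (metis comp_apply frechet_derivative_at)
  qed
  have id: "frechet_derivative (transition c c) (at (snd c x)) w = w"
    if C: "c \<in> charts_at \<A> x" for c w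
  proof -
    have CA: "c \<in> \<A>" "x \<in> fst c" using C by (auto simp: charts_at_def)
    have "((\<lambda>p. p) has_derivative (\<lambda>h. h)) (at (snd c x))" by (rule has_derivative_ident)
    then have "(transition c c has_derivative (\<lambda>h. h)) (at (snd c x))"
    proof (rule has_derivative_transform_within_open[of _ _ _ _ "snd c ` fst c"])
      show "open (snd c ` fst c)" using op[OF CA(1) dom[OF CA(1)]] by simp
      show "snd c x \<in> snd c ` fst c" using CA by blast
      show "p = transition c c p" if "p \<in> snd c ` fst c" for p
        using that by (simp add: transition_def chart_inv_def f_inv_into_f)
    qed
    then show ?thesis by (metis frechet_derivative_at)
  qed
  show "(\<lambda>v. v c) ` tangent_space \<A> x = UNIV"
  proof (intro equalityI subset_UNIV subsetI)
    fix w :: 'b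
    define v where "v = (\<lambda>d. if d \<in> charts_at \<A> x
        then frechet_derivative (transition c d) (at (snd c x)) w else 0)"
    have "v \<in> tangent_space \<A> x"
      unfolding tangent_space_def v_def using cocycle[OF c] by simp
    moreover have "v c = w" using c id by (simp add: v_def)
    ultimately show "w \<in> (\<lambda>v. v c) ` tangent_space \<A> x" by blast
  qed
qed


section \<open>Riemannian metrics and one-forms\<close>

definition linear_form_on :: "'v::real_vector set \<Rightarrow> ('v \<Rightarrow> real) \<Rightarrow> bool" where
  "linear_form_on V f \<longleftrightarrow>
     (\<forall>u\<in>V. \<forall>w\<in>V. f (u + w) = f u + f w) \<and> (\<forall>r. \<forall>u\<in>V. f (r *\<^sub>R u) = r * f u)"

definition inner_product_on :: "'v::real_vector set \<Rightarrow> ('v \<Rightarrow> 'v \<Rightarrow> real) \<Rightarrow> bool" where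
  "inner_product_on V g \<longleftrightarrow>
     (\<forall>u\<in>V. linear_form_on V (g u)) \<and> (\<forall>u\<in>V. \<forall>w\<in>V. g u w = g w u) \<and>
     (\<forall>u\<in>V. u \<noteq> 0 \<longrightarrow> g u u > 0)"

text \<open>Smoothness is smoothness of the components \<open>a\<^sub>i\<^sub>j\<close> and \<open>b\<^sub>i\<close> in every chart.\<close>

definition riemannian_metric :: "('m, 'e::euclidean_space) chart set
    \<Rightarrow> ('m \<Rightarrow> ('m, 'e) tvec \<Rightarrow> ('m, 'e) tvec \<Rightarrow> real) \<Rightarrow> bool" where
  "riemannian_metric \<A> a \<longleftrightarrow>
     (\<forall>x\<in>(\<Union>c\<in>\<A>. fst c). inner_product_on (tangent_space \<A> x) (a x)) \<and>
     (\<forall>c\<in>\<A>. \<forall>i\<in>Basis. \<forall>j\<in>Basis. smooth_on (snd c ` fst c)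
        ((\<lambda>x. a x (tvec_of \<A> x c i) (tvec_of \<A> x c j)) \<circ> chart_inv c))"

definition smooth_one_form :: "('m, 'e::euclidean_space) chart set
    \<Rightarrow> ('m \<Rightarrow> ('m, 'e) tvec \<Rightarrow> real) \<Rightarrow> bool" where
  "smooth_one_form \<A> b \<longleftrightarrow>
     (\<forall>x\<in>(\<Union>c\<in>\<A>. fst c). linear_form_on (tangent_space \<A> x) (b x)) \<and>
     (\<forall>c\<in>\<A>. \<forall>i\<in>Basis. smooth_on (snd c ` fst c)
        ((\<lambda>x. b x (tvec_of \<A> x c i)) \<circ> chart_inv c))"

definition nowhere_vanishing :: "('m, 'e::euclidean_space) chart set
    \<Rightarrow> ('m \<Rightarrow> ('m, 'e) tvec \<Rightarrow> real) \<Rightarrow> bool" where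
  "nowhere_vanishing \<A> b \<longleftrightarrow> (\<forall>x\<in>(\<Union>c\<in>\<A>. fst c). \<exists>v\<in>tangent_space \<A> x. b x v \<noteq> 0)"


section \<open>Minkowski conic norms and conic Finsler metrics\<close>

definition conic_domain :: "'v::euclidean_space set \<Rightarrow> bool" where
  "conic_domain A \<longleftrightarrow> A \<noteq> {} \<and> open A \<and> (\<forall>v\<in>A. \<forall>r>0. r *\<^sub>R v \<in> A)"

definition minkowski_conic_norm :: "'v::euclidean_space set \<Rightarrow> ('v \<Rightarrow> real) \<Rightarrow> bool" where
  "minkowski_conic_norm A N \<longleftrightarrow>
     conic_domain A \<and>
     (\<forall>v\<in>A. N v > 0) \<and>
     (\<forall>v\<in>A. \<forall>r>0. N (r *\<^sub>R v) = r * N v) \<and>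
     smooth_on A N \<and>
     (\<forall>v\<in>A. \<forall>u. u \<noteq> 0 \<longrightarrow> hessian (\<lambda>y. (N y)\<^sup>2 / 2) v u u > 0)"

text \<open>The tangent space is an \<open>n\<close>-dimensional subspace of the type of tangent vectors and not a
  Euclidean type, so its topology, smoothness and Hessians are taken through linear isomorphisms
  from the model space; they do not depend on the isomorphism.\<close>

definition linear_iso_onto :: "('e::euclidean_space \<Rightarrow> 'v::real_vector) \<Rightarrow> 'v set \<Rightarrow> bool" where
  "linear_iso_onto l V \<longleftrightarrow> linear l \<and> bij_betw l UNIV V"

lemma linear_iso_onto_tvec_of:
  assumes M: "smooth_manifold X \<A>" and c: "c \<in> charts_at \<A> x"
  shows "linear_iso_onto (tvec_of \<A> x c) (tangent_space \<A> x)"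
proof -
  note bij = bij_betw_tangent_components[OF M c]
  note sub = subspace_tangent_space[OF M, of x]
  have in_T: "tvec_of \<A> x c w \<in> tangent_space \<A> x" and comp: "tvec_of \<A> x c w c = w" for w
    using bij bij_betw_inv_into_right[OF bij, of w]
    by (auto simp: tvec_of_def bij_betw_def intro: inv_into_into)
  have eqI: "u = v" if "u \<in> tangent_space \<A> x" "v \<in> tangent_space \<A> x" "u c = v c" for u v
    using that bij unfolding bij_betw_def inj_on_def by blast
  have "linear (tvec_of \<A> x c)"
  proof (rule linearI)
    show "tvec_of \<A> x c (p + q) = tvec_of \<A> x c p + tvec_of \<A> x c q" for p q
      by (rule eqI) (auto simp: in_T comp intro: subspace_add[OF sub])
    show "tvec_of \<A> x c (r *\<^sub>R p) = r *\<^sub>R tvec_of \<A> x c p" for r p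
      by (rule eqI) (auto simp: in_T comp intro: subspace_scale[OF sub])
  qed
  moreover have "bij_betw (tvec_of \<A> x c) UNIV (tangent_space \<A> x)"
    unfolding tvec_of_def by (rule bij_betw_inv_into[OF bij])
  ultimately show ?thesis by (simp add: linear_iso_onto_def)
qed

definition conic_finsler_metric :: "('m, 'e::euclidean_space) chart set
    \<Rightarrow> ('m \<times> ('m, 'e) tvec) set \<Rightarrow> ('m \<times> ('m, 'e) tvec \<Rightarrow> real) \<Rightarrow> bool" where
  "conic_finsler_metric \<A> A F \<longleftrightarrow>
     openin (atlas_topology (tangent_atlas \<A>)) A \<and>
     fst ` A = (\<Union>c\<in>\<A>. fst c) \<and>
     (\<forall>q\<in>A. F q \<ge> 0) \<and>
     manifold_smooth_on (tangent_atlas \<A>) A F \<and>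
     (\<forall>x\<in>(\<Union>c\<in>\<A>. fst c). \<forall>l. linear_iso_onto l (tangent_space \<A> x) \<longrightarrow>
        conic_domain {w :: 'e. (x, l w) \<in> A} \<and>
        minkowski_conic_norm {w. (x, l w) \<in> A} (\<lambda>w. F (x, l w)))"


section \<open>The Kropina metric\<close>

definition kropina_domain :: "('m, 'e::euclidean_space) chart set
    \<Rightarrow> ('m \<Rightarrow> ('m, 'e) tvec \<Rightarrow> real) \<Rightarrow> ('m \<times> ('m, 'e) tvec) set" where
  "kropina_domain \<A> b = {(x, y) \<in> tangent_bundle \<A>. b x y > 0}"

definition kropina_metric :: "('m \<Rightarrow> ('m, 'e) tvec \<Rightarrow> ('m, 'e) tvec \<Rightarrow> real)
    \<Rightarrow> ('m \<Rightarrow> ('m, 'e) tvec \<Rightarrow> real) \<Rightarrow> 'm \<times> ('m, 'e) tvec \<Rightarrow> real" where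
  "kropina_metric a b = (\<lambda>(x, y). a x y y / b x y)"

end

theory Submission
  imports Defs
begin

text \<open>In a tangent chart both \<open>\<alpha>\<^sup>2\<close> and \<open>\<beta>\<close> are polynomials in the fibre coordinates with
  smooth coefficients, so \<open>F\<close> is smooth where \<open>\<beta> > 0\<close>. On a fibre, with \<open>q = \<langle>v, v\<rangle>\<close>,
  \<open>s = \<langle>v, u\<rangle>\<close>, \<open>r = \<langle>u, u\<rangle>\<close> and \<open>t = \<beta>(u) / \<beta>(v)\<close>, the Hessian of \<open>F\<^sup>2 / 2\<close> at \<open>v\<close> in the
  direction \<open>u\<close> is \<open>(4 s\<^sup>2 + 2 q r - 8 q s t + 3 q\<^sup>2 t\<^sup>2) / \<beta>(v)\<^sup>2\<close>. By Cauchy-Schwarz \<open>q r \<ge> s\<^sup>2\<close>,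
  and \<open>6 s\<^sup>2 - 8 s (q t) + 3 (q t)\<^sup>2\<close> is a positive definite form in \<open>(s, q t)\<close>.\<close>

section \<open>Calculus of smooth functions on open sets\<close>

lemma Ck_on_SucI:
  assumes "\<And>x. x \<in> S \<Longrightarrow> (f has_derivative f' x) (at x)"
    and "\<And>u. Ck_on k S (\<lambda>x. frechet_derivative f (at x) u)"
  shows "Ck_on (Suc k) S f"
  using assms by (auto simp: differentiable_def)

text \<open>Since \<open>S\<close> is open, agreement on \<open>S\<close> is agreement near each of
  its points. The directional derivatives therefore agree on \<open>S\<close> too, and the induction
  applies to them.\<close>

lemma Ck_on_cong:
  assumes "open S" "Ck_on k S f" "\<And>x. x \<in> S \<Longrightarrow> f x = g x"
  shows "Ck_on k S g"
  using assms(2,3)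
proof (induction k arbitrary: f g)
  case 0
  then show ?case by (simp cong: continuous_on_cong)
next
  case (Suc k)
  have D: "(g has_derivative frechet_derivative f (at x)) (at x)" if "x \<in> S" for x
  proof (rule has_derivative_transform_within_open[OF _ assms(1) that])
    show "(f has_derivative frechet_derivative f (at x)) (at x)"
      using Suc.prems(1) that by (simp add: frechet_derivative_works)
  qed (use Suc.prems(2) in auto)
  show ?case
  proof (rule Ck_on_SucI[OF D])
    fix u
    show "Ck_on k S (\<lambda>x. frechet_derivative g (at x) u)"
    proof (rule Suc.IH)
      show "Ck_on k S (\<lambda>x. frechet_derivative f (at x) u)"
        using Suc.prems(1) by simp
      show "frechet_derivative f (at x) u = frechet_derivative g (at x) u" if "x \<in> S" for x
        using frechet_derivative_at[OF D[OF that]] by simp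
    qed
  qed simp
qed

text \<open>Allows an explicit formula \<open>f'\<close> in place of
  \<open>frechet_derivative\<close>: by uniqueness of the derivative the two coincide on
  \<open>S\<close>.\<close>

lemma Ck_on_Suc_has_derivativeI:
  assumes "open S" and D: "\<And>x. x \<in> S \<Longrightarrow> (f has_derivative f' x) (at x)"
    and C: "\<And>u. Ck_on k S (\<lambda>x. f' x u)"
  shows "Ck_on (Suc k) S f"
proof (rule Ck_on_SucI[OF D])
  fix u
  show "Ck_on k S (\<lambda>x. frechet_derivative f (at x) u)"
    by (rule Ck_on_cong[OF assms(1) C]) (use frechet_derivative_at[OF D] in simp)
qed simp

lemma Ck_on_Suc_has_derivative:
  assumes "Ck_on (Suc k) S f" "x \<in> S"
  shows "(f has_derivative frechet_derivative f (at x)) (at x)"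
  using assms by (simp add: frechet_derivative_works)

text \<open>The recursion speaks only of derivatives, so the lower class has to be recovered by
  induction; at the bottom, differentiability gives continuity.\<close>

lemma Ck_on_SucD:
  assumes "Ck_on (Suc k) S f"
  shows "Ck_on k S f"
  using assms
proof (induction k arbitrary: f)
  case 0
  then show ?case
    by (auto intro!: continuous_at_imp_continuous_on differentiable_imp_continuous_within)
next
  case (Suc k)
  then show ?case
    unfolding Ck_on.simps(2)[of "Suc k"] Ck_on.simps(2)[of k S f] by blast
qed

section \<open>Closure properties of the classes C^k\<close>

lemma Ck_on_const: "Ck_on k S (\<lambda>x. c)"
  by (induction k arbitrary: c) (auto simp: frechet_derivative_const)

lemma Ck_on_bounded_linear:
  assumes "open S" "bounded_linear f"
  shows "Ck_on k S f"
proof (cases k)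
  case 0
  then show ?thesis using assms by (simp add: linear_continuous_on)
next
  case (Suc m)
  then show ?thesis
    using Ck_on_Suc_has_derivativeI[OF assms(1) bounded_linear_imp_has_derivative[OF assms(2)]
        Ck_on_const] by simp
qed

lemma Ck_on_add:
  assumes "open S" "Ck_on k S f" "Ck_on k S g"
  shows "Ck_on k S (\<lambda>x. f x + g x)"
  using assms(2,3)
proof (induction k arbitrary: f g)
  case 0
  then show ?case by (simp add: continuous_on_add)
next
  case (Suc k)
  show ?case
    by (rule Ck_on_Suc_has_derivativeI[OF assms(1) has_derivative_add
          [OF Ck_on_Suc_has_derivative[OF Suc.prems(1)] Ck_on_Suc_has_derivative[OF Suc.prems(2)]]])
      (use Suc in auto)
qed

lemma Ck_on_sum:
  assumes "open S" "\<And>i. i \<in> I \<Longrightarrow> Ck_on k S (f i)"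
  shows "Ck_on k S (\<lambda>x. \<Sum>i\<in>I. f i x)"
  using assms(2)
  by (induction I rule: infinite_finite_induct) (auto intro: Ck_on_const Ck_on_add[OF assms(1)])

lemma Ck_on_mult:
  fixes f g :: "'e::euclidean_space \<Rightarrow> real"
  assumes "open S" "Ck_on k S f" "Ck_on k S g"
  shows "Ck_on k S (\<lambda>x. f x * g x)"
  using assms(2,3)
proof (induction k arbitrary: f g)
  case 0
  then show ?case by (simp add: continuous_on_mult)
next
  case (Suc k)
  show ?case
  proof (rule Ck_on_Suc_has_derivativeI[OF assms(1) has_derivative_mult
          [OF Ck_on_Suc_has_derivative[OF Suc.prems(1)] Ck_on_Suc_has_derivative[OF Suc.prems(2)]]])
    fix u
    show "Ck_on k S (\<lambda>x. f x * frechet_derivative g (at x) u + frechet_derivative f (at x) u * g x)"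
      using Suc.prems Suc.prems[THEN Ck_on_SucD]
      by (intro Ck_on_add[OF assms(1)] Suc.IH) auto
  qed
qed

text \<open>The derivative of \<open>1/f\<close> is a product of the derivative of \<open>f\<close>
  and two factors \<open>1/f\<close>, and to these the induction hypothesis for the same
  \<open>f\<close> applies.\<close>

lemma Ck_on_inverse:
  fixes f :: "'e::euclidean_space \<Rightarrow> real"
  assumes "open S" "Ck_on k S f" "\<And>x. x \<in> S \<Longrightarrow> f x \<noteq> 0"
  shows "Ck_on k S (\<lambda>x. inverse (f x))"
  using assms(2)
proof (induction k)
  case 0
  then show ?case using assms(3) by (simp add: continuous_on_inverse)
next
  case (Suc k)
  show ?case
  proof (rule Ck_on_Suc_has_derivativeI[OF assms(1) Deriv.has_derivative_inverse
          [OF assms(3) Ck_on_Suc_has_derivative[OF Suc.prems]]])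
    fix u
    \<comment> \<open>The sign is written as a constant factor so that the product rule covers
      it.\<close>
    have "Ck_on k S (\<lambda>x. -1 * (inverse (f x) * frechet_derivative f (at x) u * inverse (f x)))"
      using Suc.prems Suc.IH[OF Ck_on_SucD[OF Suc.prems]]
      by (intro Ck_on_mult[OF assms(1)] Ck_on_const) auto
    then show "Ck_on k S (\<lambda>x. - (inverse (f x) * frechet_derivative f (at x) u * inverse (f x)))"
      by simp
  qed
qed

text \<open>The derivative of \<open>f \<circ> L\<close> in direction \<open>u\<close> is the
  derivative of \<open>f\<close> in direction \<open>L u\<close>, composed with \<open>L\<close>. It
  has the same shape as the original function, so the induction closes.\<close>

lemma Ck_on_compose_linear:
  assumes "open S" "bounded_linear L" "Ck_on k S f"
  shows "Ck_on k (L -` S) (\<lambda>x. f (L x))"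
  using assms(3)
proof (induction k arbitrary: f)
  case 0
  have "continuous_on (L -` S) L"
    using assms(2) by (rule linear_continuous_on)
  then show ?case
    using 0 by (auto intro: continuous_on_compose2)
next
  case (Suc k)
  have op: "open (L -` S)"
    using assms by (intro open_vimage linear_continuous_on)
  show ?case
  proof (rule Ck_on_Suc_has_derivativeI[OF op])
    fix x assume "x \<in> L -` S"
    then show "((\<lambda>x. f (L x)) has_derivative (\<lambda>h. frechet_derivative f (at (L x)) (L h))) (at x)"
      using has_derivative_compose[OF bounded_linear_imp_has_derivative[OF assms(2)]
          Ck_on_Suc_has_derivative[OF Suc.prems]] by simp
  next
    fix u
    show "Ck_on k (L -` S) (\<lambda>x. frechet_derivative f (at (L x)) (L u))"
      using Suc.prems by (intro Suc.IH) simp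
  qed
qed

lemma Ck_on_subset:
  assumes "Ck_on k S f" "T \<subseteq> S"
  shows "Ck_on k T f"
  using assms(1)
proof (induction k arbitrary: f)
  case 0
  then show ?case using assms(2) by (simp add: continuous_on_subset)
next
  case (Suc k)
  then show ?case using assms(2) by auto
qed

text \<open>Serves twice: on a single fibre, where the coefficients \<open>A\<close> and
  \<open>B\<close> are constant, and in a tangent chart, where they depend on the base
  point.\<close>

lemma smooth_on_quadratic_over_linear:
  fixes A :: "'i \<Rightarrow> 'i \<Rightarrow> 'e::euclidean_space \<Rightarrow> real"
  assumes S: "open S"
    and A: "\<And>i j. i \<in> I \<Longrightarrow> j \<in> I \<Longrightarrow> smooth_on S (A i j)"
    and B: "\<And>i. i \<in> I \<Longrightarrow> smooth_on S (B i)"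
    and y: "\<And>i. i \<in> I \<Longrightarrow> bounded_linear (y i)"
    and pos: "\<And>z. z \<in> S \<Longrightarrow> (\<Sum>i\<in>I. y i z * B i z) > 0"
    and f: "\<And>z. z \<in> S \<Longrightarrow>
      f z = (\<Sum>i\<in>I. \<Sum>j\<in>I. y i z * (y j z * A i j z)) / (\<Sum>i\<in>I. y i z * B i z)"
  shows "smooth_on S f"
  unfolding smooth_on_def
proof
  fix k
  have lin: "Ck_on k S (y i)" if "i \<in> I" for i
    using Ck_on_bounded_linear[OF S y[OF that]] .
  have "Ck_on k S (\<lambda>z. (\<Sum>i\<in>I. \<Sum>j\<in>I. y i z * (y j z * A i j z)) *
      inverse (\<Sum>i\<in>I. y i z * B i z))"
    using A B pos unfolding smooth_on_def
    by (intro Ck_on_mult[OF S] Ck_on_inverse[OF S] Ck_on_sum[OF S] lin) (auto simp: less_le)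
  then show "Ck_on k S f"
    by (rule Ck_on_cong[OF S]) (simp add: f divide_inverse)
qed

section \<open>Kropina norms on Euclidean spaces\<close>

lemma positive_definite_Cauchy_Schwarz:
  fixes g :: "'v::real_vector \<Rightarrow> 'v \<Rightarrow> real"
  assumes g: "bilinear g" and sym: "\<And>u w. g u w = g w u"
    and pos: "\<And>u. u \<noteq> 0 \<Longrightarrow> g u u > 0"
  shows "(g v u)\<^sup>2 \<le> g v v * g u u"
proof (cases "v = 0")
  case True
  then show ?thesis by (simp add: bilinear_lzero[OF g])
next
  case False
  \<comment> \<open>Up to the factor \<open>g v v\<close>, this is the component of \<open>u\<close>
    that is \<open>g\<close>-orthogonal to \<open>v\<close>; the scaling avoids a division.\<close>
  let ?w = "g v v *\<^sub>R u - g v u *\<^sub>R v"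
  have "0 \<le> g ?w ?w"
    using pos[of ?w] by (cases "?w = 0") (auto simp: bilinear_lzero[OF g])
  also have "g ?w ?w = g v v * (g v v * g u u - (g v u)\<^sup>2)"
    by (simp add: bilinear_lsub[OF g] bilinear_rsub[OF g] bilinear_lmul[OF g] bilinear_rmul[OF g]
        sym[of u v] algebra_simps power2_eq_square)
  finally show ?thesis
    using pos[OF False] by (simp add: zero_le_mult_iff)
qed

lemma kropina_hessian_form_pos:
  fixes q r s t :: real
  assumes "q > 0" "r > 0" "s\<^sup>2 \<le> q * r"
  shows "0 < 4 * s\<^sup>2 + 2 * q * r - 8 * q * s * t + 3 * q\<^sup>2 * t\<^sup>2"
proof -
  \<comment> \<open>Completing the square in \<open>q * t\<close>. If \<open>s = 0\<close> the last
    square vanishes, and positivity comes from \<open>2 * q * r\<close> instead.\<close>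
  have eq: "4 * s\<^sup>2 + 2 * q * r - 8 * q * s * t + 3 * q\<^sup>2 * t\<^sup>2 =
      2 * (q * r - s\<^sup>2) + 3 * (q * t - 4 / 3 * s)\<^sup>2 + 2 / 3 * s\<^sup>2"
    by (simp add: power2_eq_square algebra_simps)
  show ?thesis
  proof (cases "s = 0")
    case True
    then show ?thesis using assms by (simp add: add_pos_nonneg)
  next
    case False
    then have "s\<^sup>2 > 0" by simp
    then show ?thesis unfolding eq using assms(3)
      by (intro add_nonneg_pos add_nonneg_nonneg) auto
  qed
qed

lemma hessian_kropina:
  fixes g :: "'e::euclidean_space \<Rightarrow> 'e \<Rightarrow> real" and \<beta> :: "'e \<Rightarrow> real"
  assumes g: "bilinear g" and sym: "\<And>u w. g u w = g w u" and \<beta>: "linear \<beta>" and v: "\<beta> v > 0"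
  defines "t \<equiv> \<lambda>u. \<beta> u / \<beta> v"
  shows "hessian (\<lambda>y. (g y y / \<beta> y)\<^sup>2 / 2) v u u =
    (4 * (g v u)\<^sup>2 + 2 * g v v * g u u - 8 * g v v * g v u * t u + 3 * (g v v)\<^sup>2 * (t u)\<^sup>2) / (\<beta> v)\<^sup>2"
proof -
  have bl: "bounded_linear \<beta>"
    using \<beta> by (simp add: linear_conv_bounded_linear)
  interpret g: bounded_bilinear g
    using g by (simp add: bilinear_conv_bounded_bilinear)
  have op: "open {y. \<beta> y > 0}"
    using bl by (intro open_Collect_less continuous_intros linear_continuous_on)
  note d\<beta> = bounded_linear_imp_has_derivative[OF bl]
  have dq: "((\<lambda>y. g y y) has_derivative (\<lambda>h. 2 * g y h)) (at y)" for y
    by (rule has_derivative_eq_rhs[OF g.FDERIV[OF has_derivative_ident has_derivative_ident]])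
      (simp add: sym[of _ y] fun_eq_iff)
  have dg: "((\<lambda>y. g y u) has_derivative (\<lambda>h. g h u)) (at y)" for y u
    by (rule bounded_linear_imp_has_derivative[OF g.bounded_linear_left])
  \<comment> \<open>With \<open>\<iota>\<close> for \<open>1/\<beta>\<close> all derivatives below
    are polynomial in \<open>g\<close>, \<open>\<beta>\<close> and \<open>\<iota>\<close>, so no
    quotient rule enters.\<close>
  define \<iota> where "\<iota> y = inverse (\<beta> y)" for y
  have d\<iota>: "(\<iota> has_derivative (\<lambda>h. - (\<iota> y * \<beta> h * \<iota> y))) (at y)" if "\<beta> y > 0" for y
    unfolding \<iota>_def using that by (intro Deriv.has_derivative_inverse d\<beta>) simp
  let ?f = "\<lambda>y. (g y y * \<iota> y)\<^sup>2 / 2"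
  \<comment> \<open>The derivative of \<open>?f\<close> at \<open>y\<close> in direction
    \<open>u\<close>, from \<open>D(g y y) u = 2 * g y u\<close> and
    \<open>D\<iota> u = - \<iota>^2 * \<beta> u\<close>.\<close>
  let ?f' = "\<lambda>y u. 2 * (g y y * g y u * (\<iota> y)\<^sup>2) - (g y y)\<^sup>2 * (\<iota> y)^3 * \<beta> u"
  have d1: "(?f has_derivative ?f' y) (at y)" if "\<beta> y > 0" for y
    by (rule has_derivative_eq_rhs, (rule derivative_intros numeral_neq_zero dq d\<iota>[OF that])+)
      (rule ext, simp add: field_simps power2_eq_square power3_eq_cube)
  \<comment> \<open>The derivative of \<open>?f' y u\<close> at \<open>y = v\<close> in direction
    \<open>h\<close>, with \<open>u\<close> fixed. Setting \<open>h = u\<close> merges the two mixed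
    terms into the coefficient 8.\<close>
  let ?f'' = "\<lambda>h. 4 * (g v h * g v u * (\<iota> v)\<^sup>2) + 2 * (g v v * g h u * (\<iota> v)\<^sup>2)
      - 4 * (g v v * g v u * (\<iota> v)^3 * \<beta> h) - 4 * (g v v * g v h * (\<iota> v)^3 * \<beta> u)
      + 3 * ((g v v)\<^sup>2 * (\<iota> v)^4 * \<beta> u * \<beta> h)"
  have d2: "((\<lambda>y. ?f' y u) has_derivative ?f'') (at v)"
    by (rule has_derivative_eq_rhs, (rule derivative_intros dq dg d\<iota>[OF v])+)
      (rule ext, simp add: algebra_simps eval_nat_numeral)
  \<comment> \<open>The formula \<open>?f'\<close> is known only where \<open>\<beta> > 0\<close>;
    this is an open set around \<open>v\<close>, which suffices for the second derivative at
    \<open>v\<close>.\<close>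
  have "((\<lambda>y. frechet_derivative ?f (at y) u) has_derivative ?f'') (at v)"
    by (rule has_derivative_transform_within_open[OF d2 op])
      (use v frechet_derivative_at[OF d1] in \<open>auto simp: fun_eq_iff\<close>)
  from frechet_derivative_at[OF this, symmetric]
  have "hessian ?f v u u = ?f'' u"
    by (simp add: hessian_def)
  also have "\<dots> = (4 * (g v u)\<^sup>2 + 2 * g v v * g u u - 8 * g v v * g v u * (\<beta> u * \<iota> v) +
      3 * (g v v)\<^sup>2 * (\<beta> u * \<iota> v)\<^sup>2) * (\<iota> v)\<^sup>2"
    by (simp add: algebra_simps eval_nat_numeral)
  finally show ?thesis
    unfolding t_def \<iota>_def divide_inverse power_inverse .
qed

section \<open>Coordinate expansions of forms and the norm on one fibre\<close>

lemma bilinear_form_eq_sum_Basis: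
  fixes g :: "'e::euclidean_space \<Rightarrow> 'e \<Rightarrow> real"
  assumes "bilinear g"
  shows "g v w = (\<Sum>i\<in>Basis. \<Sum>j\<in>Basis. (v \<bullet> i) * ((w \<bullet> j) * g i j))"
proof -
  have "g v w = g (\<Sum>i\<in>Basis. (v \<bullet> i) *\<^sub>R i) (\<Sum>j\<in>Basis. (w \<bullet> j) *\<^sub>R j)"
    by (simp add: euclidean_representation)
  also have "\<dots> = (\<Sum>i\<in>Basis. \<Sum>j\<in>Basis. (v \<bullet> i) * ((w \<bullet> j) * g i j))"
    by (simp add: bilinear_sum[OF assms] sum.cartesian_product
        bilinear_lmul[OF assms] bilinear_rmul[OF assms] mult.left_commute)
  finally show ?thesis .
qed

lemma linear_form_eq_sum_Basis:
  fixes f :: "'e::euclidean_space \<Rightarrow> real"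
  assumes "linear f"
  shows "f w = (\<Sum>i\<in>Basis. (w \<bullet> i) * f i)"
proof -
  have "f w = f (\<Sum>i\<in>Basis. (w \<bullet> i) *\<^sub>R i)"
    by (simp add: euclidean_representation)
  also have "\<dots> = (\<Sum>i\<in>Basis. (w \<bullet> i) * f i)"
    by (simp add: linear_sum[OF assms] linear_scale[OF assms])
  finally show ?thesis .
qed

lemma minkowski_conic_norm_kropina:
  fixes g :: "'e::euclidean_space \<Rightarrow> 'e \<Rightarrow> real" and \<beta> :: "'e \<Rightarrow> real"
  assumes g: "bilinear g" and sym: "\<And>u w. g u w = g w u"
    and pos: "\<And>u. u \<noteq> 0 \<Longrightarrow> g u u > 0"
    and \<beta>: "linear \<beta>" and nz: "\<beta> u0 \<noteq> 0"
  shows "minkowski_conic_norm {w. \<beta> w > 0} (\<lambda>w. g w w / \<beta> w)"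
proof -
  have op: "open {y. \<beta> y > 0}"
    using \<beta> unfolding linear_conv_bounded_linear
    by (intro open_Collect_less continuous_intros linear_continuous_on)
  \<comment> \<open>One of \<open>u0\<close> and \<open>- u0\<close> lies in the half-space, which
    is therefore non-empty.\<close>
  have "\<beta> u0 > 0 \<or> \<beta> (- u0) > 0"
    using nz by (simp add: linear_neg[OF \<beta>]) linarith
  then have dom: "conic_domain {w. \<beta> w > 0}"
    using op by (auto simp: conic_domain_def linear_scale[OF \<beta>])
  have smooth: "smooth_on {w. \<beta> w > 0} (\<lambda>w. g w w / \<beta> w)"
  proof (rule smooth_on_quadratic_over_linear[where I = Basis and y = "\<lambda>i w. w \<bullet> i"
        and A = "\<lambda>i j w. g i j" and B = "\<lambda>i w. \<beta> i", OF op])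
    show "g z z / \<beta> z = (\<Sum>i\<in>Basis. \<Sum>j\<in>Basis. (z \<bullet> i) * ((z \<bullet> j) * g i j)) /
        (\<Sum>i\<in>Basis. (z \<bullet> i) * \<beta> i)" for z
      using bilinear_form_eq_sum_Basis[OF g, of z z] linear_form_eq_sum_Basis[OF \<beta>, of z] by simp
    show "(\<Sum>i\<in>Basis. (z \<bullet> i) * \<beta> i) > 0" if "z \<in> {w. \<beta> w > 0}" for z
      using that by (simp flip: linear_form_eq_sum_Basis[OF \<beta>])
  qed (auto simp: smooth_on_def Ck_on_const bounded_linear_inner_left)
  have nonzero: "w \<noteq> 0" if "\<beta> w > 0" for w
    using that linear_0[OF \<beta>] by auto
  show ?thesis
    unfolding minkowski_conic_norm_def
  proof (intro conjI ballI allI impI dom smooth)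
    fix v assume "v \<in> {w. \<beta> w > 0}"
    then have v: "\<beta> v > 0" by simp
    show "g v v / \<beta> v > 0"
      using v pos[OF nonzero[OF v]] by simp
    show "g (r *\<^sub>R v) (r *\<^sub>R v) / \<beta> (r *\<^sub>R v) = r * (g v v / \<beta> v)" if "r > 0" for r
      using v that
      by (simp add: bilinear_lmul[OF g] bilinear_rmul[OF g] linear_scale[OF \<beta>])
    show "hessian (\<lambda>y. (g y y / \<beta> y)\<^sup>2 / 2) v u u > 0" if "u \<noteq> 0" for u
      unfolding hessian_kropina[OF g sym \<beta> v]
      using v by (intro divide_pos_pos positive_definite_Cauchy_Schwarz[OF g sym pos]
          kropina_hessian_form_pos[OF pos[OF nonzero[OF v]] pos[OF that]]) auto
  qed
qed

section \<open>Tangent charts\<close>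

lemma smooth_manifold_chart:
  assumes "smooth_manifold X \<A>" "c \<in> \<A>"
  shows "inj_on (snd c) (fst c)" "open (snd c ` fst c)"
proof -
  have h: "openin X (fst c)" "open (snd c ` fst c)"
    "homeomorphic_map (subtopology X (fst c)) (top_of_set (snd c ` fst c)) (snd c)"
    using assms by (auto simp: smooth_manifold_def)
  show "open (snd c ` fst c)" by fact
  show "inj_on (snd c) (fst c)"
    using h by (metis homeomorphic_imp_injective_map openin_subset topspace_subtopology_subset)
qed

lemma tvec_of_in:
  assumes "smooth_manifold X \<A>" "c \<in> \<A>" "x \<in> fst c"
  shows "tvec_of \<A> x c w \<in> tangent_space \<A> x" "tvec_of \<A> x c w c = w"
proof -
  have "bij_betw (\<lambda>v. v c) (tangent_space \<A> x) UNIV"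
    using assms by (intro bij_betw_tangent_components) (auto simp: charts_at_def)
  then have "w \<in> (\<lambda>v. v c) ` tangent_space \<A> x"
    by (auto simp: bij_betw_def)
  then show "tvec_of \<A> x c w \<in> tangent_space \<A> x" "tvec_of \<A> x c w c = w"
    unfolding tvec_of_def by (rule inv_into_into, rule f_inv_into_f)
qed

lemma tvec_of_component:
  assumes "smooth_manifold X \<A>" "c \<in> \<A>" "x \<in> fst c" "v \<in> tangent_space \<A> x"
  shows "tvec_of \<A> x c (v c) = v"
proof -
  have "bij_betw (\<lambda>v. v c) (tangent_space \<A> x) UNIV"
    using assms by (intro bij_betw_tangent_components) (auto simp: charts_at_def)
  then show ?thesis
    using assms(4) unfolding tvec_of_def bij_betw_def by (metis (no_types, lifting) inv_into_f_f)
qed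

text \<open>\<open>chart_inv\<close> is a choice of preimage, so the formula rests on injectivity of
  the tangent chart: the base point is determined by the chart \<open>c\<close>, and then the vector
  by its component at \<open>c\<close>.\<close>

lemma chart_inv_tangent_chart:
  assumes M: "smooth_manifold X \<A>" and c: "c \<in> \<A>" and p: "p \<in> snd c ` fst c"
  defines "x \<equiv> chart_inv c p"
  shows "x \<in> fst c" "snd c x = p" "chart_inv (tangent_chart \<A> c) (p, w) = (x, tvec_of \<A> x c w)"
proof -
  show x: "x \<in> fst c" "snd c x = p"
    using p unfolding x_def chart_inv_def by (auto intro: inv_into_into f_inv_into_f)
  note tv = tvec_of_in[OF M c x(1)]
  have "inj_on (snd (tangent_chart \<A> c)) (fst (tangent_chart \<A> c))"
  proof (rule inj_onI)
    fix q q'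
    assume q: "q \<in> fst (tangent_chart \<A> c)" "q' \<in> fst (tangent_chart \<A> c)"
      and eq: "snd (tangent_chart \<A> c) q = snd (tangent_chart \<A> c) q'"
    obtain y v y' v' where [simp]: "q = (y, v)" "q' = (y', v')" by fastforce
    have "y = y'"
      using q eq inj_onD[OF smooth_manifold_chart(1)[OF M c]] by (auto simp: tangent_chart_def)
    moreover have "v = v'"
      using q eq tvec_of_component[OF M c, of y v] tvec_of_component[OF M c, of y v'] \<open>y = y'\<close>
      by (auto simp: tangent_chart_def)
    ultimately show "q = q'" by simp
  qed
  moreover have "(x, tvec_of \<A> x c w) \<in> fst (tangent_chart \<A> c)"
    "snd (tangent_chart \<A> c) (x, tvec_of \<A> x c w) = (p, w)"
    using x tv by (auto simp: tangent_chart_def)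
  ultimately show "chart_inv (tangent_chart \<A> c) (p, w) = (x, tvec_of \<A> x c w)"
    unfolding chart_inv_def by (metis inv_into_f_f)
qed

section \<open>Pullback of forms along linear isomorphisms\<close>

lemma linear_form_on_linear_iso:
  assumes "linear_form_on V f" "linear_iso_onto l V"
  shows "linear (\<lambda>w. f (l w))"
proof -
  have "linear l" "l w \<in> V" for w
    using assms(2) by (auto simp: linear_iso_onto_def bij_betw_def)
  then show ?thesis
    using assms(1) by (intro linearI) (auto simp: linear_form_on_def linear_add linear_scale)
qed

lemma inner_product_on_linear_iso:
  assumes g: "inner_product_on V g" and l: "linear_iso_onto l V"
  shows "bilinear (\<lambda>v w. g (l v) (l w))" "g (l v) (l w) = g (l w) (l v)"
    "v \<noteq> 0 \<Longrightarrow> g (l v) (l v) > 0"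
proof -
  have l': "linear l" "l w \<in> V" "inj l" for w
    using l by (auto simp: linear_iso_onto_def bij_betw_def)
  show sym: "g (l v) (l w) = g (l w) (l v)" for v w
    using g l' by (auto simp: inner_product_on_def)
  have lin: "linear (\<lambda>w. g (l v) (l w))" for v
    using g l l'(2) by (intro linear_form_on_linear_iso) (auto simp: inner_product_on_def)
  \<comment> \<open>\<open>inner_product_on\<close> states linearity in the second argument;
    symmetry carries it over to the first.\<close>
  moreover have "(\<lambda>v. g (l v) (l w)) = (\<lambda>v. g (l w) (l v))" for w
    by (rule ext) (rule sym)
  ultimately show "bilinear (\<lambda>v w. g (l v) (l w))"
    unfolding bilinear_def by metis
  show "g (l v) (l v) > 0" if "v \<noteq> 0"
    using g l' that linear_injective_0[OF l'(1)] by (auto simp: inner_product_on_def)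
qed

section \<open>The Kropina metric\<close>

lemma one_form_in_chart:
  assumes M: "smooth_manifold X \<A>" and b: "smooth_one_form \<A> b" and c: "c \<in> \<A>" and x: "x \<in> fst c"
  shows "b x (tvec_of \<A> x c w) = (\<Sum>i\<in>Basis. (w \<bullet> i) * b x (tvec_of \<A> x c i))"
proof -
  have "linear_iso_onto (tvec_of \<A> x c) (tangent_space \<A> x)"
    using c x by (intro linear_iso_onto_tvec_of[OF M]) (auto simp: charts_at_def)
  then have "linear (\<lambda>w. b x (tvec_of \<A> x c w))"
    using b c x by (intro linear_form_on_linear_iso[where l = "tvec_of \<A> x c"]) (auto simp: smooth_one_form_def)
  then show ?thesis by (rule linear_form_eq_sum_Basis)
qed

lemma riemannian_metric_in_chart:
  assumes M: "smooth_manifold X \<A>" and a: "riemannian_metric \<A> a" and c: "c \<in> \<A>" and x: "x \<in> fst c"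
  shows "a x (tvec_of \<A> x c w) (tvec_of \<A> x c w) =
    (\<Sum>i\<in>Basis. \<Sum>j\<in>Basis. (w \<bullet> i) * ((w \<bullet> j) * a x (tvec_of \<A> x c i) (tvec_of \<A> x c j)))"
proof -
  have "linear_iso_onto (tvec_of \<A> x c) (tangent_space \<A> x)"
    using c x by (intro linear_iso_onto_tvec_of[OF M]) (auto simp: charts_at_def)
  then have "bilinear (\<lambda>v w. a x (tvec_of \<A> x c v) (tvec_of \<A> x c w))"
    using a c x by (intro inner_product_on_linear_iso[where l = "tvec_of \<A> x c"])
      (auto simp: riemannian_metric_def)
  then show ?thesis by (rule bilinear_form_eq_sum_Basis)
qed

text \<open>Lifts the component functions of \<open>a\<close> and \<open>b\<close> from a chart of
  the manifold to the tangent chart, where they are constant along the fibres.\<close>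

lemma smooth_on_fst:
  assumes "open S" "smooth_on S f" "T \<subseteq> S \<times> UNIV"
  shows "smooth_on T (\<lambda>z. f (fst z))"
  unfolding smooth_on_def
proof
  fix k
  have "Ck_on k (fst -` S) (\<lambda>z. f (fst z))"
    using assms by (intro Ck_on_compose_linear bounded_linear_fst) (auto simp: smooth_on_def)
  then show "Ck_on k T (\<lambda>z. f (fst z))"
    by (rule Ck_on_subset) (use assms(3) in auto)
qed

text \<open>The Kropina domain in the coordinates of the tangent chart of \<open>c\<close>. It is
  written with the components of \<open>b\<close> because their smoothness is what
  \<open>smooth_one_form\<close> provides.\<close>

definition one_form_pos_set where
  "one_form_pos_set \<A> b c = {z \<in> snd c ` fst c \<times> UNIV.
     0 < (\<Sum>i\<in>Basis. (snd z \<bullet> i) * b (chart_inv c (fst z)) (tvec_of \<A> (chart_inv c (fst z)) c i))}"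

lemma open_one_form_pos_set:
  assumes M: "smooth_manifold X \<A>" and b: "smooth_one_form \<A> b" and c: "c \<in> \<A>"
  shows "open (one_form_pos_set \<A> b c)"
proof -
  let ?S = "snd c ` fst c \<times> (UNIV :: 'b set)"
  have op: "open ?S"
    using smooth_manifold_chart(2)[OF M c] by (simp add: open_Times)
  have "smooth_on ?S (\<lambda>z. ((\<lambda>x. b x (tvec_of \<A> x c i)) \<circ> chart_inv c) (fst z))"
    if "i \<in> Basis" for i
    using b c that by (intro smooth_on_fst[OF smooth_manifold_chart(2)[OF M c]])
      (auto simp: smooth_one_form_def comp_def)
  then have "continuous_on ?S (\<lambda>z. b (chart_inv c (fst z)) (tvec_of \<A> (chart_inv c (fst z)) c i))"
    if "i \<in> Basis" for i
    using that unfolding smooth_on_def comp_def by (metis (no_types, lifting) Ck_on.simps(1))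
  then have "continuous_on ?S (\<lambda>z. \<Sum>i\<in>Basis. (snd z \<bullet> i) *
      b (chart_inv c (fst z)) (tvec_of \<A> (chart_inv c (fst z)) c i))"
    by (intro continuous_intros)
  \<comment> \<open>The set is the preimage of the open ray of positive reals under the coordinate
    expression of \<open>\<beta>\<close>.\<close>
  from continuous_open_preimage[OF this op open_greaterThan[of 0]] show ?thesis
    by (rule back_subst[of "open"]) (auto simp: one_form_pos_set_def)
qed

lemma kropina_domain_in_chart:
  assumes M: "smooth_manifold X \<A>" and b: "smooth_one_form \<A> b" and c: "c \<in> \<A>"
    and q: "q \<in> fst (tangent_chart \<A> c)"
  shows "q \<in> kropina_domain \<A> b \<longleftrightarrow> snd (tangent_chart \<A> c) q \<in> one_form_pos_set \<A> b c"
proof -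
  obtain x v where [simp]: "q = (x, v)" by fastforce
  have x: "x \<in> fst c" "v \<in> tangent_space \<A> x"
    using q by (auto simp: tangent_chart_def)
  have "chart_inv c (snd c x) = x"
    using x smooth_manifold_chart(1)[OF M c] by (simp add: chart_inv_def)
  moreover have "b x v = (\<Sum>i\<in>Basis. (v c \<bullet> i) * b x (tvec_of \<A> x c i))"
    using one_form_in_chart[OF M b c x(1), of "v c"] tvec_of_component[OF M c x] by simp
  ultimately show ?thesis
    using c x
    by (auto simp: kropina_domain_def tangent_bundle_def tangent_chart_def one_form_pos_set_def)
qed

text \<open>For surjectivity, a coordinate pair \<open>(p, w)\<close> comes from the tangent vector
  at \<open>chart_inv c p\<close> with components \<open>w\<close>.\<close>

lemma image_kropina_domain_tangent_chart:
  assumes M: "smooth_manifold X \<A>" and b: "smooth_one_form \<A> b" and c: "c \<in> \<A>"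
  shows "snd (tangent_chart \<A> c) ` (fst (tangent_chart \<A> c) \<inter> kropina_domain \<A> b) =
    one_form_pos_set \<A> b c"
proof (intro equalityI subsetI)
  fix z assume "z \<in> snd (tangent_chart \<A> c) ` (fst (tangent_chart \<A> c) \<inter> kropina_domain \<A> b)"
  then show "z \<in> one_form_pos_set \<A> b c"
    using kropina_domain_in_chart[OF M b c] by auto
next
  fix z assume z: "z \<in> one_form_pos_set \<A> b c"
  obtain p w where [simp]: "z = (p, w)" by fastforce
  have p: "p \<in> snd c ` fst c"
    using z by (auto simp: one_form_pos_set_def)
  let ?q = "(chart_inv c p, tvec_of \<A> (chart_inv c p) c w)"
  note x = chart_inv_tangent_chart(1,2)[OF M c p]
  have q: "?q \<in> fst (tangent_chart \<A> c)" "snd (tangent_chart \<A> c) ?q = z"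
    using x tvec_of_in[OF M c x(1)] by (auto simp: tangent_chart_def)
  then have "?q \<in> kropina_domain \<A> b"
    using kropina_domain_in_chart[OF M b c q(1)] z by simp
  then show "z \<in> snd (tangent_chart \<A> c) ` (fst (tangent_chart \<A> c) \<inter> kropina_domain \<A> b)"
    using q by (metis IntI imageI)
qed

text \<open>The tangent charts cover the domain, and its part in each of them is a generator of the
  atlas topology, with \<open>W\<close> the open set \<open>one_form_pos_set\<close>.\<close>

lemma openin_kropina_domain:
  assumes M: "smooth_manifold X \<A>" and b: "smooth_one_form \<A> b"
  shows "openin (atlas_topology (tangent_atlas \<A>)) (kropina_domain \<A> b)"
proof -
  let ?U = "\<lambda>c. {q \<in> fst (tangent_chart \<A> c). snd (tangent_chart \<A> c) q \<in> one_form_pos_set \<A> b c}"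
  have "kropina_domain \<A> b \<subseteq> (\<Union>c\<in>\<A>. fst (tangent_chart \<A> c))"
    by (auto simp: kropina_domain_def tangent_bundle_def tangent_chart_def)
  then have "kropina_domain \<A> b = (\<Union>c\<in>\<A>. ?U c)"
    using kropina_domain_in_chart[OF M b] by blast
  moreover have "openin (atlas_topology (tangent_atlas \<A>)) (?U c)" if "c \<in> \<A>" for c
    unfolding atlas_topology_def
  proof (rule topology_generated_by_Basis)
    show "?U c \<in> {{q \<in> fst c. snd c q \<in> W} | c W. c \<in> tangent_atlas \<A> \<and> open W}"
      using that open_one_form_pos_set[OF M b that] unfolding tangent_atlas_def by blast
  qed
  ultimately show ?thesis by (metis (no_types, lifting) openin_clauses(3) imageE)
qed

text \<open>In a tangent chart \<open>snd z\<close> holds the fibre coordinates and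
  \<open>fst z\<close> the base point, so \<open>F\<close> is a quadratic form in
  \<open>snd z\<close> over a linear one, with coefficients smooth in \<open>fst z\<close>.\<close>

lemma manifold_smooth_on_kropina:
  assumes M: "smooth_manifold X \<A>" and a: "riemannian_metric \<A> a" and b: "smooth_one_form \<A> b"
  shows "manifold_smooth_on (tangent_atlas \<A>) (kropina_domain \<A> b) (kropina_metric a b)"
proof -
  have "smooth_on (one_form_pos_set \<A> b c) (kropina_metric a b \<circ> chart_inv (tangent_chart \<A> c))"
    if c: "c \<in> \<A>" for c
  proof (rule smooth_on_quadratic_over_linear[where I = Basis and y = "\<lambda>i z. snd z \<bullet> i"
        and A = "\<lambda>i j z. ((\<lambda>x. a x (tvec_of \<A> x c i) (tvec_of \<A> x c j)) \<circ> chart_inv c) (fst z)"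
        and B = "\<lambda>i z. ((\<lambda>x. b x (tvec_of \<A> x c i)) \<circ> chart_inv c) (fst z)"])
    have sub: "one_form_pos_set \<A> b c \<subseteq> snd c ` fst c \<times> UNIV"
      by (auto simp: one_form_pos_set_def)
    show "open (one_form_pos_set \<A> b c)"
      by (rule open_one_form_pos_set[OF M b c])
    show "smooth_on (one_form_pos_set \<A> b c)
        (\<lambda>z. ((\<lambda>x. a x (tvec_of \<A> x c i) (tvec_of \<A> x c j)) \<circ> chart_inv c) (fst z))"
      if "i \<in> Basis" "j \<in> Basis" for i j
      using a c that by (intro smooth_on_fst[OF smooth_manifold_chart(2)[OF M c] _ sub])
        (auto simp: riemannian_metric_def comp_def)
    show "smooth_on (one_form_pos_set \<A> b c)
        (\<lambda>z. ((\<lambda>x. b x (tvec_of \<A> x c i)) \<circ> chart_inv c) (fst z))" if "i \<in> Basis" for i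
      using b c that by (intro smooth_on_fst[OF smooth_manifold_chart(2)[OF M c] _ sub])
        (auto simp: smooth_one_form_def comp_def)
    show "bounded_linear (\<lambda>z. snd z \<bullet> i)" for i :: 'b
      by (intro bounded_linear_compose[OF bounded_linear_inner_left bounded_linear_snd])
    fix z assume z: "z \<in> one_form_pos_set \<A> b c"
    then show "0 < (\<Sum>i\<in>Basis. (snd z \<bullet> i) * ((\<lambda>x. b x (tvec_of \<A> x c i)) \<circ> chart_inv c) (fst z))"
      by (simp add: one_form_pos_set_def)
    obtain p w where [simp]: "z = (p, w)" by fastforce
    have p: "p \<in> snd c ` fst c"
      using z by (auto simp: one_form_pos_set_def)
    note x = chart_inv_tangent_chart[OF M c p]
    show "(kropina_metric a b \<circ> chart_inv (tangent_chart \<A> c)) z =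
      (\<Sum>i\<in>Basis. \<Sum>j\<in>Basis. (snd z \<bullet> i) * ((snd z \<bullet> j) *
        ((\<lambda>x. a x (tvec_of \<A> x c i) (tvec_of \<A> x c j)) \<circ> chart_inv c) (fst z))) /
      (\<Sum>i\<in>Basis. (snd z \<bullet> i) * ((\<lambda>x. b x (tvec_of \<A> x c i)) \<circ> chart_inv c) (fst z))"
      by (simp add: kropina_metric_def x(3)
          flip: riemannian_metric_in_chart[OF M a c x(1)] one_form_in_chart[OF M b c x(1)])
  qed
  then show ?thesis
    unfolding manifold_smooth_on_def tangent_atlas_def
    using image_kropina_domain_tangent_chart[OF M b] by simp
qed

section \<open>Fibrewise properties and the conclusion\<close>

text \<open>An arbitrary \<open>l\<close> pulls \<open>a x\<close> and \<open>b x\<close> back to an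
  inner product and a nonzero linear form on the model space, which reduces the claim to the
  Euclidean case.\<close>

lemma minkowski_conic_norm_kropina_fibre:
  assumes a: "riemannian_metric \<A> a" and b: "smooth_one_form \<A> b"
    and nv: "nowhere_vanishing \<A> b" and x: "x \<in> (\<Union>c\<in>\<A>. fst c)"
    and l: "linear_iso_onto l (tangent_space \<A> x)"
  shows "minkowski_conic_norm {w. (x, l w) \<in> kropina_domain \<A> b} (\<lambda>w. kropina_metric a b (x, l w))"
proof -
  have range: "range l = tangent_space \<A> x"
    using l by (auto simp: linear_iso_onto_def bij_betw_def)
  have lf: "linear_form_on (tangent_space \<A> x) (b x)"
    and ip: "inner_product_on (tangent_space \<A> x) (a x)"
    using a b x by (auto simp: riemannian_metric_def smooth_one_form_def)
  obtain v where v: "v \<in> range l" "b x v \<noteq> 0"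
    using nv x unfolding nowhere_vanishing_def range by blast
  then obtain u0 where "v = l u0" by (elim rangeE)
  with v have "b x (l u0) \<noteq> 0" by simp
  then have "minkowski_conic_norm {w. b x (l w) > 0} (\<lambda>w. a x (l w) (l w) / b x (l w))"
    by (intro minkowski_conic_norm_kropina[OF inner_product_on_linear_iso[OF ip l]
          linear_form_on_linear_iso[OF lf l]])
  moreover have "(x, l w) \<in> kropina_domain \<A> b \<longleftrightarrow> b x (l w) > 0" for w
    using x range by (auto simp: kropina_domain_def tangent_bundle_def)
  ultimately show ?thesis
    by (simp add: kropina_metric_def)
qed

lemma kropina_metric_pos:
  assumes a: "riemannian_metric \<A> a" and b: "smooth_one_form \<A> b" and q: "q \<in> kropina_domain \<A> b"
  shows "kropina_metric a b q > 0"
proof -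
  obtain x y where [simp]: "q = (x, y)" by fastforce
  have x: "x \<in> (\<Union>c\<in>\<A>. fst c)" and y: "y \<in> tangent_space \<A> x" "b x y > 0"
    using q by (auto simp: kropina_domain_def tangent_bundle_def)
  have lf: "linear_form_on (tangent_space \<A> x) (b x)"
    and ip: "inner_product_on (tangent_space \<A> x) (a x)"
    using a b x by (auto simp: riemannian_metric_def smooth_one_form_def)
  \<comment> \<open>Homogeneity with the scalar 0 shows that \<open>b x\<close> vanishes at the zero
    vector, so \<open>b x y > 0\<close> forces \<open>y\<close> to be nonzero.\<close>
  have "b x (0 *\<^sub>R y) = 0 * b x y"
    using lf y unfolding linear_form_on_def by blast
  then have "y \<noteq> 0" using y by auto
  then show ?thesis
    using ip y by (simp add: kropina_metric_def inner_product_on_def)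
qed

lemma fst_image_kropina_domain:
  assumes M: "smooth_manifold X \<A>" and b: "smooth_one_form \<A> b" and nv: "nowhere_vanishing \<A> b"
  shows "fst ` kropina_domain \<A> b = (\<Union>c\<in>\<A>. fst c)"
proof (intro equalityI subsetI)
  fix x assume "x \<in> fst ` kropina_domain \<A> b"
  then show "x \<in> (\<Union>c\<in>\<A>. fst c)"
    unfolding kropina_domain_def tangent_bundle_def by force
next
  fix x assume x: "x \<in> (\<Union>c\<in>\<A>. fst c)"
  then obtain v where v: "v \<in> tangent_space \<A> x" "b x v \<noteq> 0"
    using nv unfolding nowhere_vanishing_def by blast
  have lf: "linear_form_on (tangent_space \<A> x) (b x)"
    using b x unfolding smooth_one_form_def by blast
  \<comment> \<open>Scaling by \<open>b x v\<close> turns the value of the form into a square, which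
    is positive whatever the sign of \<open>b x v\<close>.\<close>
  define y where "y = b x v *\<^sub>R v"
  have "b x y = b x v * b x v"
    using lf v unfolding linear_form_on_def y_def by blast
  then have "b x y > 0"
    using v(2) by (metis not_real_square_gt_zero)
  moreover have "y \<in> tangent_space \<A> x"
    unfolding y_def by (rule subspace_scale[OF subspace_tangent_space[OF M] v(1)])
  ultimately have "(x, y) \<in> kropina_domain \<A> b"
    using x by (auto simp: kropina_domain_def tangent_bundle_def)
  then show "x \<in> fst ` kropina_domain \<A> b" by force
qed

theorem proposition4p1:
  fixes X :: "'m topology"
    and \<A> :: "('m, real ^ 'n) chart set"
    and a :: "'m \<Rightarrow> ('m, real ^ 'n) tvec \<Rightarrow> ('m, real ^ 'n) tvec \<Rightarrow> real"
    and b :: "'m \<Rightarrow> ('m, real ^ 'n) tvec \<Rightarrow> real"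
  assumes "smooth_manifold X \<A>"
    and "CARD('n) \<ge> 2"
    and "riemannian_metric \<A> a"
    and "smooth_one_form \<A> b"
    and "nowhere_vanishing \<A> b"
  shows "kropina_metric a b \<in> kropina_domain \<A> b \<rightarrow> {0<..} \<and>
         conic_finsler_metric \<A> (kropina_domain \<A> b) (kropina_metric a b)"
proof
  note pos = kropina_metric_pos[OF assms(3,4)]
  note fibre = minkowski_conic_norm_kropina_fibre[OF assms(3-5)]
  show "kropina_metric a b \<in> kropina_domain \<A> b \<rightarrow> {0<..}"
    using pos by auto
  show "conic_finsler_metric \<A> (kropina_domain \<A> b) (kropina_metric a b)"
    unfolding conic_finsler_metric_def
    using openin_kropina_domain[OF assms(1,4)] fst_image_kropina_domain[OF assms(1,4,5)]
      less_imp_le[OF pos] manifold_smooth_on_kropina[OF assms(1,3,4)] fibre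
      \<comment> \<open>The separate requirement of a conic domain is the first conjunct of the
        Minkowski property.\<close>
      fibre[unfolded minkowski_conic_norm_def, THEN conjunct1]
    by blast
qed

end
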